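(* Let $f:\mathbb{R}^n\to\mathbb{R}$ be continuously differentiable with $\|\nabla f(x)-\nabla f(y)\|\le L\|x-y\|$ for all $x,y\in\mathbb{R}^n$, where $L>0$. Let $\{x^k\}$ be a sequence generated by the inexact gradient descent method with momentum (IGDm, see context) on $X=\mathbb{R}^n$ with parameters $\nu\in(0,1)$, $\tau>0$, $\{\beta_k\},\{\gamma_k\}\subset[0,\infty)$, $\bar\beta=\sup_k\beta_k<1$, $\bar\delta=\sup_k|\beta_k-\gamma_k|<\infty$, and suppose that $\nabla f(x^k_{\rm ex})\neq 0$ for all $k\in\mathbb{N}$ and $$\max\{L\tau,\ 2L\tau\bar\delta+(L\tau+1)\bar\beta^2\}<1-\nu.$$ If $\inf_{k\in\mathbb{N}}f(x^k)>-\infty$, then the following hold. (i) $\nabla f(x^k)\to 0$ as $k\to\infty$. (ii) If $f$ satisfies the basic PLK condition at an accumulation point $\bar x$ of $\{x^k\}$, then $\{x^k\}$ converges to $\bar x$, and $\bar x$ is a stationary point of $f$. (iii) Assume that $f$ satisfies the PLK condition at an accumulation point $\bar x$ of $\{x^k\}$ with the desingularizing function $\psi(t)=Mt^{1-q}$, where $M>0$ and $q\in[0,1)$. Then: - if $q\in[0,1/2]$, the sequences $\{x^k\}$, $\{\nabla f(x^k)\}$, $\{f(x^k)\}$ converge linearly to $\bar x$, $0$, $f(\bar x)$, respectively; - if $q\in(1/2,1)$, then as $k\to\infty$ $$\|x^k-\bar x\|=\mathcal{O}\big(k^{-\frac{1-q}{2q-1}}\big),\quad \|\nabla f(x^k)\|=\mathcal{O}\big(k^{-\frac{1-q}{2q-1}}\big),\quad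 f(x^k)-f(\bar x)=\mathcal{O}\big(k^{-\frac{2-2q}{2q-1}}\big).$$
   Context: $\|\cdot\|$ is the Euclidean norm and $\mathbb{N}=\{1,2,\dots\}$. IGDm: choose $x^0=x^1\in X$, $\{\beta_k\},\{\gamma_k\}\subset[0,\infty)$, $\nu\in(0,1)$, $\tau>0$ with $\bar\beta:=\sup_k\beta_k<1$ and $\bar\delta:=\sup_k|\beta_k-\gamma_k|<\infty$. For each $k\ge1$ put $x^k_{\rm in}:=x^k+\beta_k(x^k-x^{k-1})$, $x^k_{\rm ex}:=x^k+\gamma_k(x^k-x^{k-1})$, $x^{k+1}:=x^k_{\rm in}-\tau g^k$, where $g^k\in\mathbb{R}^n$ is any vector satisfying $\|g^k-\nabla f(x^k_{\rm ex})\|\le\nu\|g^k\|$. PLK (Polyak-Łojasiewicz-Kurdyka) condition for a $C^1$ function $f$ at $\bar x$ with desingularizing function $\varphi$: there are $\eta\in(0,\infty]$, a neighborhood $U$ of $\bar x$ and a concave function $\varphi:[0,\eta)\to[0,\infty)$ such that $\varphi(0)=0$, $\varphi$ is $C^1$ on $(0,\eta)$, $\varphi'>0$ on $(0,\eta)$, and $\varphi'(f(x)-f(\bar x))\|\nabla f(x)\|\ge1$ for all $x\in U$ with $f(\bar x)<f(x)<f(\bar x)+\eta$. The basic PLK condition means that this holds with some $\varphi$ of this kind. A stationary point of $f$ is a point where $\nabla f$ vanishes. A sequence $\{u^k\}$ converges linearly to $u$ if $\|u^k-u\|=\mathcal{O}(\mu^k)$ for some $\mu\in(0,1)$ (R-linear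 convergence). *)

theory Defs
  imports "HOL-Analysis.Analysis" "HOL-Library.Landau_Symbols"
begin

text \<open>Meaningful only at points of differentiability.\<close>
definition gradient :: "('a::euclidean_space \<Rightarrow> real) \<Rightarrow> 'a \<Rightarrow> 'a" where
  "gradient f x = (THE D. GDERIV f x :> D)"

lemma GDERIV_imp_gradient:
  assumes "GDERIV f x :> D"
  shows "gradient f x = D"
  unfolding gradient_def
proof (rule the_equality)
  show "GDERIV f x :> D" by (fact assms)
next
  fix D' assume "GDERIV f x :> D'"
  have "(\<lambda>h. inner h D) = (\<lambda>h. inner h D')"
    by (rule has_derivative_unique[of f _ x])
       (use assms \<open>GDERIV f x :> D'\<close> in \<open>simp_all add: gderiv_def\<close>)
  then have "\<forall>h. inner h D = inner h D'" by (simp add: fun_eq_iff)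
  then show "D' = D" by (simp only: vector_eq_ldot)
qed

lemma differentiable_GDERIV_gradient:
  fixes f :: "'a::euclidean_space \<Rightarrow> real"
  assumes "f differentiable (at x)"
  shows "GDERIV f x :> gradient f x"
proof -
  obtain f' where f': "(f has_derivative f') (at x)"
    using assms by (auto simp: differentiable_def)
  then have "linear f'" by (rule has_derivative_linear)
  then have "f' = (\<lambda>h. inner h (\<Sum>b\<in>Basis. f' b *\<^sub>R b))"
  proof (intro ext)
    fix h
    have "f' h = f' (\<Sum>b\<in>Basis. inner h b *\<^sub>R b)"
      by (simp add: euclidean_representation)
    also have "\<dots> = (\<Sum>b\<in>Basis. inner h b * f' b)"
      using \<open>linear f'\<close> by (simp add: linear_sum linear_scale)
    also have "\<dots> = inner h (\<Sum>b\<in>Basis. f' b *\<^sub>R b)"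
      by (simp add: inner_sum_right mult.commute)
    finally show "f' h = inner h (\<Sum>b\<in>Basis. f' b *\<^sub>R b)" .
  qed
  then have "GDERIV f x :> (\<Sum>b\<in>Basis. f' b *\<^sub>R b)"
    using f' by (simp add: gderiv_def)
  then show ?thesis by (simp add: GDERIV_imp_gradient)
qed

definition continuously_differentiable :: "('a::euclidean_space \<Rightarrow> real) \<Rightarrow> bool" where
  "continuously_differentiable f \<longleftrightarrow>
     (\<forall>x. f differentiable (at x)) \<and> continuous_on UNIV (gradient f)"

text \<open>All sequences are functions on \<^typ>\<open>nat\<close>; for the parameters only the values at
  indices \<open>k \<ge> 1\<close> matter. The boundedness assumptions in \<open>IGDm\<close> below make the
  following real suprema the actual suprema.\<close>

definition beta_bar :: "(nat \<Rightarrow> real) \<Rightarrow> real" where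
  "beta_bar \<beta> = (SUP k\<in>{1..}. \<beta> k)"

definition delta_bar :: "(nat \<Rightarrow> real) \<Rightarrow> (nat \<Rightarrow> real) \<Rightarrow> real" where
  "delta_bar \<beta> \<gamma> = (SUP k\<in>{1..}. \<bar>\<beta> k - \<gamma> k\<bar>)"

text \<open>Gives \<open>x\<^sub>i\<^sub>n\<close> for the coefficients \<open>\<beta>\<close> and \<open>x\<^sub>e\<^sub>x\<close> for the coefficients \<open>\<gamma>\<close>;
  used only for \<open>k \<ge> 1\<close>.\<close>
definition extrapolation :: "(nat \<Rightarrow> real) \<Rightarrow> (nat \<Rightarrow> 'a::euclidean_space) \<Rightarrow> nat \<Rightarrow> 'a" where
  "extrapolation \<beta> x k = x k + \<beta> k *\<^sub>R (x k - x (k - 1))"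

text \<open>\<open>x\<close> is a sequence generated, on the whole space, by the inexact gradient descent
  method with momentum for \<open>f\<close>.\<close>
definition IGDm ::
  "('a::euclidean_space \<Rightarrow> real) \<Rightarrow> (nat \<Rightarrow> real) \<Rightarrow> (nat \<Rightarrow> real) \<Rightarrow> real \<Rightarrow> real
    \<Rightarrow> (nat \<Rightarrow> 'a) \<Rightarrow> bool" where
  "IGDm f \<beta> \<gamma> \<nu> \<tau> x \<longleftrightarrow>
     (\<forall>k\<ge>1. 0 \<le> \<beta> k) \<and> (\<forall>k\<ge>1. 0 \<le> \<gamma> k) \<and>
     0 < \<nu> \<and> \<nu> < 1 \<and> 0 < \<tau> \<and>
     bdd_above (\<beta> ` {1..}) \<and> beta_bar \<beta> < 1 \<and>
     bdd_above ((\<lambda>k. \<bar>\<beta> k - \<gamma> k\<bar>) ` {1..}) \<and>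
     x 0 = x 1 \<and>
     (\<forall>k\<ge>1. \<exists>g. norm (g - gradient f (extrapolation \<gamma> x k)) \<le> \<nu> * norm g \<and>
        x (k + 1) = extrapolation \<beta> x k - \<tau> *\<^sub>R g)"

definition desingularizing :: "ereal \<Rightarrow> (real \<Rightarrow> real) \<Rightarrow> bool" where
  "desingularizing \<eta> \<phi> \<longleftrightarrow>
     concave_on {t. 0 \<le> t \<and> ereal t < \<eta>} \<phi> \<and>
     (\<forall>t. 0 \<le> t \<and> ereal t < \<eta> \<longrightarrow> 0 \<le> \<phi> t) \<and>
     \<phi> 0 = 0 \<and>
     (\<forall>t. 0 < t \<and> ereal t < \<eta> \<longrightarrow> \<phi> differentiable (at t)) \<and>
     continuous_on {t. 0 < t \<and> ereal t < \<eta>} (deriv \<phi>) \<and>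
     (\<forall>t. 0 < t \<and> ereal t < \<eta> \<longrightarrow> 0 < deriv \<phi> t)"

text \<open>The function \<open>\<phi>\<close> is total here; only its values on \<open>[0, \<eta>)\<close> matter.\<close>
definition PLK :: "('a::euclidean_space \<Rightarrow> real) \<Rightarrow> 'a \<Rightarrow> (real \<Rightarrow> real) \<Rightarrow> bool" where
  "PLK f z \<phi> \<longleftrightarrow>
     (\<exists>\<eta> U. 0 < \<eta> \<and> open U \<and> z \<in> U \<and> desingularizing \<eta> \<phi> \<and>
        (\<forall>x\<in>U. f z < f x \<and> ereal (f x) < ereal (f z) + \<eta> \<longrightarrow>
           1 \<le> deriv \<phi> (f x - f z) * norm (gradient f x)))"

definition basic_PLK :: "('a::euclidean_space \<Rightarrow> real) \<Rightarrow> 'a \<Rightarrow> bool" where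
  "basic_PLK f z \<longleftrightarrow> (\<exists>\<phi>. PLK f z \<phi>)"

definition accumulation_point :: "(nat \<Rightarrow> 'a::topological_space) \<Rightarrow> 'a \<Rightarrow> bool" where
  "accumulation_point x z \<longleftrightarrow> (\<exists>r. strict_mono r \<and> (x \<circ> r) \<longlonglongrightarrow> z)"

definition stationary_point :: "('a::euclidean_space \<Rightarrow> real) \<Rightarrow> 'a \<Rightarrow> bool" where
  "stationary_point f z \<longleftrightarrow> f differentiable (at z) \<and> gradient f z = 0"

text \<open>R-linear convergence.\<close>
definition converges_linearly :: "(nat \<Rightarrow> 'a::real_normed_vector) \<Rightarrow> 'a \<Rightarrow> bool" where
  "converges_linearly u l \<longleftrightarrow>
     (\<exists>\<mu>. 0 < \<mu> \<and> \<mu> < 1 \<and> (\<lambda>k. norm (u k - l)) \<in> O(\<lambda>k. \<mu> ^ k))"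

end

theory Submission
  imports Defs
begin

text \<open>Along the iterates the merit value \<open>H k = f (x k) + c * \<parallel>x k - x (k - 1)\<parallel>\<^sup>2\<close> drops by at
  least a multiple of \<open>(D k)\<^sup>2\<close>, where \<open>D k\<close> bounds both neighbouring steps and, up to a constant,
  the gradient at \<open>x k\<close>. If \<open>\<phi>\<close> desingularizes \<open>f\<close> at \<open>z\<close>, then
  \<open>\<Phi> t = A * (2 * \<phi> (t / 2) + 2 * sqrt t)\<close> desingularizes the merit function for a large constant
  \<open>A\<close>, in the sense that \<open>\<Phi>' (H k - f z) * D k \<ge> 1\<close> near \<open>z\<close>. Concavity then makes
  \<open>\<Phi> (H k - f z)\<close> drop by at least a multiple of \<open>D k\<close>, which bounds the length of the trajectory.
  For \<open>\<phi> t = M * t powr (1 - q)\<close> the residual \<open>r k = H k - f z\<close> satisfies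
  \<open>r k - r (k + 1) \<ge> C * r k powr (2 * max q (1 / 2))\<close>, which gives the rates.\<close>

lemma lipschitz_gradient_upper_bound:
  fixes f :: "'a::real_inner \<Rightarrow> real"
  assumes deriv: "\<And>z. GDERIV f z :> G z"
    and lip: "\<And>y z. norm (G y - G z) \<le> L * norm (y - z)"
  shows "f y \<le> f x + inner (G x) (y - x) + L / 2 * (norm (y - x))\<^sup>2"
proof -
  define v where "v = y - x"
  define h where "h t = f (x + t *\<^sub>R v) - t * inner (G x) v - L / 2 * t\<^sup>2 * (norm v)\<^sup>2" for t
  have "h 1 \<le> h 0"
  proof (rule DERIV_nonpos_imp_nonincreasing[of 0 1 h])
    fix t :: real assume t: "0 \<le> t" "t \<le> 1"
    have "((\<lambda>t. f (x + t *\<^sub>R v)) has_derivative (\<lambda>s. inner (s *\<^sub>R v) (G (x + t *\<^sub>R v)))) (at t)"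
      by (rule has_derivative_compose[of "\<lambda>t. x + t *\<^sub>R v" _ _ _ f])
         (use deriv in \<open>auto intro!: derivative_eq_intros simp: gderiv_def\<close>)
    then have f': "((\<lambda>t. f (x + t *\<^sub>R v)) has_real_derivative inner v (G (x + t *\<^sub>R v))) (at t)"
      unfolding has_field_derivative_def by (rule has_derivative_eq_rhs) auto
    have h': "(h has_real_derivative
        inner v (G (x + t *\<^sub>R v)) - inner (G x) v - L * t * (norm v)\<^sup>2) (at t)"
      unfolding h_def by (rule derivative_eq_intros f' refl | simp)+
    have "inner v (G (x + t *\<^sub>R v)) - inner (G x) v = inner (G (x + t *\<^sub>R v) - G x) v"
      by (simp add: inner_diff_left inner_diff_right inner_commute)
    also have "\<dots> \<le> norm (G (x + t *\<^sub>R v) - G x) * norm v"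
      by (rule norm_cauchy_schwarz)
    also have "\<dots> \<le> (L * norm (t *\<^sub>R v)) * norm v"
      using lip[of "x + t *\<^sub>R v" x] by (intro mult_right_mono) auto
    also have "\<dots> = L * t * (norm v)\<^sup>2"
      using t by (simp add: power2_eq_square)
    finally show "\<exists>d. (h has_real_derivative d) (at t) \<and> d \<le> 0"
      using h' by force
  qed simp
  then show ?thesis by (simp add: h_def v_def)
qed

lemma lipschitz_gradient_lower_bound:
  fixes f :: "'a::real_inner \<Rightarrow> real"
  assumes deriv: "\<And>z. GDERIV f z :> G z"
    and lip: "\<And>y z. norm (G y - G z) \<le> L * norm (y - z)"
  shows "f x + inner (G x) (y - x) - L / 2 * (norm (y - x))\<^sup>2 \<le> f y"
proof -
  have "- f y \<le> - f x + inner (- G x) (y - x) + L / 2 * (norm (y - x))\<^sup>2"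
  proof (rule lipschitz_gradient_upper_bound)
    show "GDERIV (\<lambda>x. - f x) z :> - G z" for z
      by (rule GDERIV_minus[OF deriv])
    show "norm (- G y - - G z) \<le> L * norm (y - z)" for y z
      using lip[of y z] by (simp add: norm_minus_commute)
  qed
  then show ?thesis by simp
qed

lemma momentum_step_decrease:
  fixes f :: "'a::real_inner \<Rightarrow> real"
  assumes deriv: "\<And>z. GDERIV f z :> G z"
    and lip: "\<And>y z. norm (G y - G z) \<le> L * norm (y - z)"
    and "0 < L" "0 < \<tau>" "0 \<le> \<nu>" "0 \<le> \<beta>" "\<beta> \<le> B" "\<bar>\<beta> - \<gamma>\<bar> \<le> \<delta>"
    and err: "norm (g - G (x + \<gamma> *\<^sub>R d)) \<le> \<nu> * norm g"
    and y: "y = x + \<beta> *\<^sub>R d - \<tau> *\<^sub>R g"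
  shows "2 * \<tau> * (f y - f x) \<le> (L * \<tau> * \<delta> + (L * \<tau> + 1) * B\<^sup>2) * (norm d)\<^sup>2
    - (1 - \<nu> - L * \<tau> * \<delta>) * (norm (y - x))\<^sup>2 - (1 - \<nu> - L * \<tau>) * (\<tau> * norm g)\<^sup>2"
proof -
  define z where "z = x + \<beta> *\<^sub>R d"
  define D where "D = norm d"
  define E where "E = norm (y - x)"
  define S where "S = \<tau> * norm g"
  have nonneg: "0 \<le> D" "0 \<le> E" "0 \<le> S" using \<open>0 < \<tau>\<close> by (auto simp: D_def E_def S_def)
  have "norm (y - z) = S" "norm (x - z) = \<beta> * D"
    using y \<open>0 < \<tau>\<close> \<open>0 \<le> \<beta>\<close> by (auto simp: z_def S_def D_def)
  then have "f y \<le> f z + inner (G z) (y - z) + L / 2 * S\<^sup>2"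
    "f z + inner (G z) (x - z) - L / 2 * (\<beta> * D)\<^sup>2 \<le> f x"
    using lipschitz_gradient_upper_bound[OF deriv lip, of y z]
      lipschitz_gradient_lower_bound[OF deriv lip, of z x] by auto
  then have 1: "f y - f x \<le> inner (G z) (y - x) + L / 2 * S\<^sup>2 + L / 2 * (\<beta> * D)\<^sup>2"
    by (simp add: inner_diff_right)
  have "norm (g - G z) \<le> norm (g - G (x + \<gamma> *\<^sub>R d)) + norm (G (x + \<gamma> *\<^sub>R d) - G z)"
    using norm_triangle_ineq[of "g - G (x + \<gamma> *\<^sub>R d)" "G (x + \<gamma> *\<^sub>R d) - G z"] by simp
  also have "\<dots> \<le> \<nu> * norm g + L * norm ((\<gamma> - \<beta>) *\<^sub>R d)"
    using err lip[of "x + \<gamma> *\<^sub>R d" z] by (simp add: z_def algebra_simps)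
  also have "\<dots> \<le> \<nu> * norm g + L * \<delta> * D"
    using \<open>0 < L\<close> assms(8) by (auto simp: D_def abs_minus_commute intro!: mult_right_mono)
  finally have "norm (g - G z) * E \<le> (\<nu> * norm g + L * \<delta> * D) * E"
    by (intro mult_right_mono nonneg)
  moreover have "inner (G z - g) (y - x) \<le> norm (g - G z) * E"
    using norm_cauchy_schwarz[of "G z - g" "y - x"] by (simp add: E_def norm_minus_commute)
  ultimately have "inner (G z) (y - x) \<le> inner g (y - x) + (\<nu> * norm g + L * \<delta> * D) * E"
    by (simp add: inner_diff_left)
  then have "2 * \<tau> * inner (G z) (y - x) \<le>
      2 * \<tau> * (inner g (y - x) + (\<nu> * norm g + L * \<delta> * D) * E)"
    using \<open>0 < \<tau>\<close> by (intro mult_left_mono) auto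
  also have "\<dots> = 2 * inner (\<tau> *\<^sub>R g) (y - x) + 2 * \<nu> * S * E + 2 * L * \<tau> * \<delta> * D * E"
    by (simp add: S_def algebra_simps)
  also have "2 * inner (\<tau> *\<^sub>R g) (y - x) = (\<beta> * D)\<^sup>2 - E\<^sup>2 - S\<^sup>2"
  proof -
    have "(\<beta> * D)\<^sup>2 = (norm (\<tau> *\<^sub>R g + (y - x)))\<^sup>2"
      using y by (simp add: D_def power_mult_distrib)
    also have "\<dots> = S\<^sup>2 + E\<^sup>2 + 2 * inner (\<tau> *\<^sub>R g) (y - x)"
      unfolding power2_norm_eq_inner E_def S_def power_mult_distrib
      by (simp add: inner_add_left inner_add_right inner_commute power2_eq_square)
    finally show ?thesis by simp
  qed
  also have "2 * \<nu> * S * E \<le> \<nu> * (S\<^sup>2 + E\<^sup>2)"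
    using mult_left_mono[OF sum_squares_bound[of S E] \<open>0 \<le> \<nu>\<close>] by (simp add: algebra_simps)
  also have "2 * L * \<tau> * \<delta> * D * E \<le> L * \<tau> * \<delta> * (D\<^sup>2 + E\<^sup>2)"
    using mult_left_mono[OF sum_squares_bound[of D E], of "L * \<tau> * \<delta>"] assms(3,4,8)
    by (simp add: algebra_simps)
  finally have 2: "2 * \<tau> * inner (G z) (y - x) \<le>
      (\<beta> * D)\<^sup>2 - E\<^sup>2 - S\<^sup>2 + \<nu> * (S\<^sup>2 + E\<^sup>2) + L * \<tau> * \<delta> * (D\<^sup>2 + E\<^sup>2)"
    by simp
  have "2 * \<tau> * (f y - f x) \<le> 2 * \<tau> * (inner (G z) (y - x) + L / 2 * S\<^sup>2 + L / 2 * (\<beta> * D)\<^sup>2)"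
    using 1 \<open>0 < \<tau>\<close> by (intro mult_left_mono) auto
  also have "\<dots> \<le> (L * \<tau> + 1) * (\<beta> * D)\<^sup>2 + L * \<tau> * \<delta> * D\<^sup>2
      - (1 - \<nu> - L * \<tau> * \<delta>) * E\<^sup>2 - (1 - \<nu> - L * \<tau>) * S\<^sup>2"
    using 2 by (simp add: algebra_simps)
  also have "(L * \<tau> + 1) * (\<beta> * D)\<^sup>2 \<le> (L * \<tau> + 1) * (B * D)\<^sup>2"
    using assms(3,4,6,7) nonneg by (intro mult_left_mono power_mono mult_right_mono) auto
  finally show ?thesis
    by (simp add: D_def E_def S_def algebra_simps)
qed

lemma IGDm_merit_decrease:
  fixes f :: "'a::euclidean_space \<Rightarrow> real"
  assumes deriv: "\<And>z. GDERIV f z :> gradient f z"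
    and lip: "\<And>y z. norm (gradient f y - gradient f z) \<le> L * norm (y - z)"
    and L: "0 < L" and igd: "IGDm f \<beta> \<gamma> \<nu> \<tau> x"
    and nonstat: "\<And>k. k \<ge> 1 \<Longrightarrow> gradient f (extrapolation \<gamma> x k) \<noteq> 0"
    and par: "max (L * \<tau>)
        (2 * L * \<tau> * delta_bar \<beta> \<gamma> + (L * \<tau> + 1) * (beta_bar \<beta>)\<^sup>2) < 1 - \<nu>"
  obtains c \<rho> K D where "0 < c" "0 < \<rho>" "0 < K"
    and "\<And>k. k \<ge> 1 \<Longrightarrow> 0 < D k"
    and "\<And>k. k \<ge> 1 \<Longrightarrow> norm (x k - x (k - 1)) \<le> D k"
    and "\<And>k. k \<ge> 1 \<Longrightarrow> dist (x (Suc k)) (x k) \<le> D k"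
    and "\<And>k. k \<ge> 1 \<Longrightarrow> norm (gradient f (x k)) \<le> K * D k"
    and "\<And>k. k \<ge> 1 \<Longrightarrow> \<rho> * (D k)\<^sup>2 \<le> (f (x k) + c * (norm (x k - x (k - 1)))\<^sup>2)
           - (f (x (Suc k)) + c * (norm (x (Suc k) - x k))\<^sup>2)"
proof -
  define B where "B = beta_bar \<beta>"
  define \<delta> where "\<delta> = delta_bar \<beta> \<gamma>"
  have \<nu>: "0 < \<nu>" "\<nu> < 1" and \<tau>: "0 < \<tau>"
    and \<beta>0: "\<And>k. k \<ge> 1 \<Longrightarrow> 0 \<le> \<beta> k" and \<gamma>0: "\<And>k. k \<ge> 1 \<Longrightarrow> 0 \<le> \<gamma> k"
    using igd by (auto simp: IGDm_def)
  have \<beta>B: "\<beta> k \<le> B" if "k \<ge> 1" for k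
    using igd that unfolding IGDm_def B_def beta_bar_def by (intro cSUP_upper) auto
  have \<delta>: "\<bar>\<beta> k - \<gamma> k\<bar> \<le> \<delta>" if "k \<ge> 1" for k
    using igd that cSUP_upper[of k "{1..}" "\<lambda>k. \<bar>\<beta> k - \<gamma> k\<bar>"]
    unfolding IGDm_def \<delta>_def delta_bar_def by auto
  have B0: "0 \<le> B" and \<delta>0: "0 \<le> \<delta>"
    using \<beta>0[of 1] \<beta>B[of 1] \<delta>[of 1] by auto
  obtain g where g: "\<And>k. k \<ge> 1 \<Longrightarrow> norm (g k - gradient f (extrapolation \<gamma> x k)) \<le> \<nu> * norm (g k)"
    and xS: "\<And>k. k \<ge> 1 \<Longrightarrow> x (Suc k) = extrapolation \<beta> x k - \<tau> *\<^sub>R g k"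
    using igd unfolding IGDm_def by (metis Suc_eq_plus1)
  define a where "a = L * \<tau> * \<delta> + (L * \<tau> + 1) * B\<^sup>2"
  define b where "b = 1 - \<nu> - L * \<tau> * \<delta>"
  define s where "s = 1 - \<nu> - L * \<tau>"
  have "0 \<le> a" "a < b" "0 < s"
    using par L \<tau> \<delta>0 by (auto simp: a_def b_def s_def B_def \<delta>_def)
  define c where "c = (a + b) / 2 / (2 * \<tau>)"
  define \<rho> where "\<rho> = min ((b - a) / 2) (s * \<tau>\<^sup>2) / (6 * \<tau>)"
  define D where "D k = norm (x k - x (k - 1)) + norm (x (Suc k) - x k) + norm (g k)" for k
  define K where "K = 1 + \<nu> + L * (B + \<delta>)"
  have ge: "norm (x k - x (k - 1)) \<le> D k" "norm (x (Suc k) - x k) \<le> D k" "norm (g k) \<le> D k" for k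
    by (auto simp: D_def)
  have "0 < c" "0 < \<rho>" "0 < K"
    using \<open>0 \<le> a\<close> \<open>a < b\<close> \<open>0 < s\<close> \<tau> \<nu> L B0 \<delta>0
    by (auto simp: c_def \<rho>_def K_def intro!: divide_pos_pos add_pos_nonneg)
  show ?thesis
  proof (rule that[of c \<rho> K D])
    show "0 < c" "0 < \<rho>" "0 < K" by fact+
  next
    fix k :: nat assume k: "k \<ge> 1"
    define d where "d = x k - x (k - 1)"
    have ex: "extrapolation \<gamma> x k = x k + \<gamma> k *\<^sub>R d"
      and xin: "extrapolation \<beta> x k = x k + \<beta> k *\<^sub>R d" by (auto simp: extrapolation_def d_def)
    have "g k \<noteq> 0" using g[OF k] nonstat[OF k] by auto
    then have "0 < norm (g k)" by simp
    then show "0 < D k" using ge(3) by (rule less_le_trans)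
    show "norm (x k - x (k - 1)) \<le> D k" "dist (x (Suc k)) (x k) \<le> D k"
      using ge by (auto simp: dist_norm)
    have grad_ex: "norm (gradient f (x k + \<gamma> k *\<^sub>R d)) \<le> (1 + \<nu>) * norm (g k)"
      using g[OF k] norm_triangle_sub[of "gradient f (x k + \<gamma> k *\<^sub>R d)" "g k"]
      by (simp add: ex norm_minus_commute algebra_simps)
    have "norm (gradient f (x k)) \<le> norm (gradient f (x k + \<gamma> k *\<^sub>R d))
        + norm (gradient f (x k) - gradient f (x k + \<gamma> k *\<^sub>R d))"
      using norm_triangle_sub by blast
    also have "\<dots> \<le> (1 + \<nu>) * norm (g k) + L * (\<gamma> k * norm d)"
      using grad_ex lip[of "x k" "x k + \<gamma> k *\<^sub>R d"] \<gamma>0[OF k] by auto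
    also have "\<dots> \<le> (1 + \<nu>) * D k + L * ((B + \<delta>) * D k)"
      using ge[of k] \<nu> L \<gamma>0[OF k] \<beta>B[OF k] \<delta>[OF k]
      by (intro add_mono mult_left_mono mult_mono) (auto simp: d_def)
    finally show "norm (gradient f (x k)) \<le> K * D k"
      by (simp add: K_def algebra_simps)
    define P where "P = norm d"
    define Q where "Q = norm (x (Suc k) - x k)"
    define R where "R = norm (g k)"
    have step: "2 * \<tau> * (f (x (Suc k)) - f (x k)) \<le> a * P\<^sup>2 - b * Q\<^sup>2 - s * (\<tau> * R)\<^sup>2"
      unfolding a_def b_def s_def P_def Q_def R_def
      by (rule momentum_step_decrease[OF deriv lip L \<tau> _ \<beta>0[OF k] \<beta>B[OF k] \<delta>[OF k]])
         (use \<nu> g[OF k] xS[OF k] ex xin in auto)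
    have "D k = P + Q + R" by (simp add: D_def P_def Q_def R_def d_def)
    then have "3 * (P\<^sup>2 + Q\<^sup>2 + R\<^sup>2) - (D k)\<^sup>2 = (P - Q)\<^sup>2 + (Q - R)\<^sup>2 + (P - R)\<^sup>2"
      by (simp add: power2_eq_square algebra_simps)
    then have "(D k)\<^sup>2 \<le> 3 * (P\<^sup>2 + Q\<^sup>2 + R\<^sup>2)"
      by (smt (verit) zero_le_power2)
    then have "2 * \<tau> * (\<rho> * (D k)\<^sup>2) \<le> 2 * \<tau> * (\<rho> * (3 * (P\<^sup>2 + Q\<^sup>2 + R\<^sup>2)))"
      using \<open>0 < \<rho>\<close> \<tau> by (intro mult_left_mono) auto
    also have "\<dots> = min ((b - a) / 2) (s * \<tau>\<^sup>2) * (P\<^sup>2 + Q\<^sup>2 + R\<^sup>2)"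
      using \<tau> by (simp add: \<rho>_def field_simps)
    also have "\<dots> \<le> (b - a) / 2 * P\<^sup>2 + (b - a) / 2 * Q\<^sup>2 + s * \<tau>\<^sup>2 * R\<^sup>2"
      unfolding distrib_left by (intro add_mono mult_right_mono min.cobounded1 min.cobounded2) auto
    also have "\<dots> \<le> 2 * \<tau> * (f (x k) - f (x (Suc k))) + (a + b) / 2 * P\<^sup>2 - (a + b) / 2 * Q\<^sup>2"
      using step by (simp add: field_simps)
    also have "\<dots> = 2 * \<tau> * ((f (x k) + c * P\<^sup>2) - (f (x (Suc k)) + c * Q\<^sup>2))"
      using \<tau> by (simp add: c_def field_simps)
    finally have "\<rho> * (D k)\<^sup>2 \<le> (f (x k) + c * P\<^sup>2) - (f (x (Suc k)) + c * Q\<^sup>2)"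
      using \<tau> by simp
    then show "\<rho> * (D k)\<^sup>2 \<le> (f (x k) + c * (norm (x k - x (k - 1)))\<^sup>2)
           - (f (x (Suc k)) + c * (norm (x (Suc k) - x k))\<^sup>2)"
      by (simp add: P_def Q_def d_def)
  qed
qed

lemma desingularized_descent_converges:
  fixes u :: "nat \<Rightarrow> 'a::metric_space"
  assumes "0 < e" "0 < \<epsilon>" "0 < \<rho>"
    and r_pos: "\<And>k. k \<ge> m \<Longrightarrow> 0 < r k"
    and r_lim: "r \<longlonglongrightarrow> 0"
    and dec: "\<And>k. k \<ge> m \<Longrightarrow> \<rho> * (D k)\<^sup>2 \<le> r k - r (Suc k)"
    and step: "\<And>k. k \<ge> m \<Longrightarrow> dist (u (Suc k)) (u k) \<le> D k"
    and slope: "\<And>k. k \<ge> m \<Longrightarrow> dist (u k) z < \<epsilon> \<Longrightarrow> r k < e \<Longrightarrow> 1 \<le> w (r k) * D k"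
    and w_nonneg: "\<And>t. 0 < t \<Longrightarrow> t < e \<Longrightarrow> 0 \<le> w t"
    and \<Phi>_nonneg: "\<And>t. 0 < t \<Longrightarrow> t < e \<Longrightarrow> 0 \<le> \<Phi> t"
    and tangent: "\<And>s t. 0 < s \<Longrightarrow> s \<le> t \<Longrightarrow> t < e \<Longrightarrow> w t * (t - s) \<le> \<Phi> t - \<Phi> s"
    and acc: "accumulation_point u z"
  obtains N where "N \<ge> m" "u \<longlonglongrightarrow> z"
    and "\<And>k. k \<ge> N \<Longrightarrow> r k < e \<and> 1 \<le> w (r k) * D k \<and> \<rho> * dist (u k) z \<le> \<Phi> (r k)"
proof -
  obtain s where s: "strict_mono s" "(u \<circ> s) \<longlonglongrightarrow> z"
    using acc by (auto simp: accumulation_point_def)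
  have "eventually (\<lambda>k. r k < e) sequentially"
    using order_tendstoD(2)[OF r_lim] \<open>0 < e\<close> by blast
  then obtain n where n: "\<And>k. k \<ge> n \<Longrightarrow> r k < e"
    by (auto simp: eventually_sequentially)
  define p where "p = max m n"
  have p: "k \<ge> m" "0 < r k" "r k < e" if "k \<ge> p" for k
    using that n r_pos by (auto simp: p_def)
  have r_dec: "r (Suc k) \<le> r k" if "k \<ge> p" for k
  proof -
    have "0 \<le> \<rho> * (D k)\<^sup>2" using \<open>0 < \<rho>\<close> by simp
    then show ?thesis using dec[OF p(1)[OF that]] by linarith
  qed
  have \<Phi>_step: "w (r k) * (r k - r (Suc k)) \<le> \<Phi> (r k) - \<Phi> (r (Suc k))" if "k \<ge> p" for k
    using that by (intro tangent p r_dec) auto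
  have \<Phi>_dec: "\<Phi> (r (Suc k)) \<le> \<Phi> (r k)" if "k \<ge> p" for k
  proof -
    have "0 \<le> w (r k) * (r k - r (Suc k))"
      using that r_dec[OF that] by (intro mult_nonneg_nonneg w_nonneg p) auto
    then show ?thesis using \<Phi>_step[OF that] by linarith
  qed
  have "decseq (\<lambda>j. \<Phi> (r (p + j)))"
    using \<Phi>_dec by (auto simp: decseq_Suc_iff)
  moreover have "0 \<le> \<Phi> (r (p + j))" for j
    using p[of "p + j"] \<Phi>_nonneg by auto
  ultimately obtain l where "(\<lambda>j. \<Phi> (r (p + j))) \<longlonglongrightarrow> l" and l': "\<And>j. l \<le> \<Phi> (r (p + j))"
    using decseq_convergent by metis
  then have l_lim: "(\<lambda>k. \<Phi> (r k)) \<longlonglongrightarrow> l"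
    using LIMSEQ_offset[of "\<lambda>k. \<Phi> (r k)" p l] by (simp add: add.commute)
  have l: "l \<le> \<Phi> (r k)" if "k \<ge> p" for k
    using l'[of "k - p"] that by simp
  have "0 \<le> l"
    using l_lim \<Phi>_nonneg p by (intro LIMSEQ_le_const[OF l_lim]) blast
  have len: "\<rho> * dist (u (Suc k)) (u k) \<le> \<Phi> (r k) - \<Phi> (r (Suc k))"
    if "k \<ge> p" "dist (u k) z < \<epsilon>" for k
  proof -
    have w1: "1 \<le> w (r k) * D k" and "0 \<le> w (r k)"
      using slope[OF p(1) that(2) p(3)] w_nonneg[OF p(2,3)] that(1) by auto
    have "0 \<le> D k" using step[OF p(1)[OF that(1)]] zero_le_dist order_trans by blast
    have "\<rho> * D k * 1 \<le> \<rho> * D k * (w (r k) * D k)"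
      using w1 \<open>0 \<le> D k\<close> \<open>0 < \<rho>\<close> by (intro mult_left_mono) auto
    also have "\<dots> = w (r k) * (\<rho> * (D k)\<^sup>2)" by (simp add: power2_eq_square)
    also have "\<dots> \<le> w (r k) * (r k - r (Suc k))"
      using \<open>0 \<le> w (r k)\<close> dec[OF p(1)[OF that(1)]] by (intro mult_left_mono) auto
    also have "\<dots> \<le> \<Phi> (r k) - \<Phi> (r (Suc k))" by (rule \<Phi>_step[OF that(1)])
    finally have "\<rho> * D k \<le> \<Phi> (r k) - \<Phi> (r (Suc k))" by simp
    moreover have "\<rho> * dist (u (Suc k)) (u k) \<le> \<rho> * D k"
      using step[OF p(1)[OF that(1)]] \<open>0 < \<rho>\<close> by (intro mult_left_mono) auto
    ultimately show ?thesis by linarith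
  qed
  have "eventually (\<lambda>j. \<Phi> (r (s j)) < l + \<rho> * \<epsilon> / 2) sequentially"
    using order_tendstoD(2)[OF LIMSEQ_subseq_LIMSEQ[OF l_lim s(1)], of "l + \<rho> * \<epsilon> / 2"] \<open>0 < \<rho>\<close> \<open>0 < \<epsilon>\<close>
    by (simp add: o_def)
  moreover have "eventually (\<lambda>j. dist (u (s j)) z < \<epsilon> / 2) sequentially"
    using tendstoD[OF s(2), of "\<epsilon> / 2"] \<open>0 < \<epsilon>\<close> by simp
  moreover have "eventually (\<lambda>j. p \<le> s j) sequentially"
    using filterlim_subseq[OF s(1)] by (simp add: filterlim_at_top)
  ultimately have "eventually (\<lambda>j. \<Phi> (r (s j)) < l + \<rho> * \<epsilon> / 2 \<and> dist (u (s j)) z < \<epsilon> / 2 \<and> p \<le> s j) sequentially"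
    by eventually_elim auto
  then obtain N where N: "\<Phi> (r N) < l + \<rho> * \<epsilon> / 2" "dist (u N) z < \<epsilon> / 2" "p \<le> N"
    by (auto simp: eventually_sequentially)
  have near: "dist (u k) z < \<epsilon>" if "\<rho> * dist (u k) (u N) \<le> \<Phi> (r N) - \<Phi> (r k)" "k \<ge> N" for k
  proof -
    have "\<rho> * dist (u k) (u N) < \<rho> * (\<epsilon> / 2)"
      using that(1) N(1) l[of k] that(2) N(3) by simp
    then have "dist (u k) (u N) < \<epsilon> / 2" using \<open>0 < \<rho>\<close> by simp
    then show ?thesis using N(2) dist_triangle[of "u k" z "u N"] by linarith
  qed
  have chain: "\<rho> * dist (u (Suc j)) (u k) \<le> \<Phi> (r k) - \<Phi> (r (Suc j))"
    if "\<rho> * dist (u j) (u k) \<le> \<Phi> (r k) - \<Phi> (r j)" "dist (u j) z < \<epsilon>" "j \<ge> p" for j k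
  proof -
    have "\<rho> * dist (u (Suc j)) (u k) \<le> \<rho> * (dist (u (Suc j)) (u j) + dist (u j) (u k))"
      using \<open>0 < \<rho>\<close> by (intro mult_left_mono dist_triangle) auto
    then show ?thesis using len[OF that(3,2)] that(1) by (simp add: algebra_simps)
  qed
  have from_N: "\<rho> * dist (u k) (u N) \<le> \<Phi> (r N) - \<Phi> (r k)" if "k \<ge> N" for k
    using that
  proof (induction k rule: dec_induct)
    case (step j)
    then show ?case using N(3) by (intro chain near) auto
  qed simp
  then have good: "dist (u k) z < \<epsilon>" if "k \<ge> N" for k
    using that near by blast
  have from_k: "\<rho> * dist (u j) (u k) \<le> \<Phi> (r k) - \<Phi> (r j)" if "k \<ge> N" "j \<ge> k" for j k
    using that(2)
  proof (induction j rule: dec_induct)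
    case (step j)
    then show ?case using N(3) that(1) by (intro chain good) auto
  qed simp
  have bound: "\<rho> * dist (u k) z \<le> \<Phi> (r k) - l" if "k \<ge> N" for k
  proof (rule tendsto_le)
    show "(\<lambda>j. \<Phi> (r k) - \<Phi> (r (s j))) \<longlonglongrightarrow> \<Phi> (r k) - l"
      using LIMSEQ_subseq_LIMSEQ[OF l_lim s(1)] by (intro tendsto_intros) (simp add: o_def)
    show "(\<lambda>j. \<rho> * dist (u (s j)) (u k)) \<longlonglongrightarrow> \<rho> * dist (u k) z"
      using s(2) by (subst dist_commute[of "u k"]) (auto intro!: tendsto_intros simp: o_def)
    have "eventually (\<lambda>j. k \<le> s j) sequentially"
      using filterlim_subseq[OF s(1)] by (simp add: filterlim_at_top)
    then show "eventually (\<lambda>j. \<rho> * dist (u (s j)) (u k) \<le> \<Phi> (r k) - \<Phi> (r (s j))) sequentially"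
      by eventually_elim (use from_k that in auto)
  qed simp
  have "(\<lambda>k. dist (u k) z) \<longlonglongrightarrow> 0"
  proof (rule tendsto_sandwich[of "\<lambda>_. 0"])
    show "(\<lambda>k. (\<Phi> (r k) - l) / \<rho>) \<longlonglongrightarrow> 0"
      using tendsto_divide[OF tendsto_diff[OF l_lim tendsto_const[of l]] tendsto_const[of \<rho>]]
        \<open>0 < \<rho>\<close> by simp
    show "eventually (\<lambda>k. dist (u k) z \<le> (\<Phi> (r k) - l) / \<rho>) sequentially"
      using bound \<open>0 < \<rho>\<close> by (auto simp: eventually_sequentially field_simps)
  qed auto
  then have "u \<longlonglongrightarrow> z" by (rule tendsto_dist_iff[THEN iffD2])
  show ?thesis
  proof (rule that[of N])
    show "m \<le> N" using N(3) by (simp add: p_def)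
    show "u \<longlonglongrightarrow> z" by fact
    show "r k < e \<and> 1 \<le> w (r k) * D k \<and> \<rho> * dist (u k) z \<le> \<Phi> (r k)" if "k \<ge> N" for k
    proof -
      have "p \<le> k" using that N(3) by simp
      then show ?thesis
        using p[of k] slope[of k] good[OF that] bound[OF that] \<open>0 \<le> l\<close> by auto
    qed
  qed
qed

lemma desingularizing_tangent:
  assumes "desingularizing \<eta> \<phi>"
    and t: "0 < t" "ereal t < \<eta>" and s: "0 \<le> s" "ereal s < \<eta>"
  shows "\<phi> s \<le> \<phi> t + deriv \<phi> t * (s - t)"
proof -
  define S where "S = {t. 0 \<le> t \<and> ereal t < \<eta>}"
  have conv: "convex_on S (\<lambda>t. - \<phi> t)"
    using assms(1) by (auto simp: desingularizing_def S_def concave_on_def)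
  have "open {t. ereal t < \<eta>}"
    by (intro open_Collect_less continuous_intros)
  then have "open ({0<..} \<inter> {t. ereal t < \<eta>})" by (intro open_Int open_greaterThan)
  moreover have "{0<..} \<inter> {t. ereal t < \<eta>} \<subseteq> S" by (auto simp: S_def)
  ultimately have "t \<in> interior S" using t interior_maximal by blast
  moreover have "convex S" using conv by (rule convex_on_imp_convex)
  moreover have "((\<lambda>t. - \<phi> t) has_real_derivative - deriv \<phi> t) (at t within S)"
  proof -
    have "\<phi> differentiable (at t)" using assms(1) t by (auto simp: desingularizing_def)
    then have "(\<phi> has_real_derivative deriv \<phi> t) (at t)"
      using DERIV_deriv_iff_real_differentiable by blast
    then show ?thesis by (intro DERIV_minus) (rule has_field_derivative_at_within)
  qed
  moreover have "s \<in> S" using s by (simp add: S_def)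
  ultimately have "- deriv \<phi> t * (s - t) \<le> - \<phi> s - - \<phi> t"
    by (intro convex_on_imp_above_tangent[OF conv] convex_connected)
  then show ?thesis by simp
qed

text \<open>The merit value \<open>r\<close> is controlled by \<open>\<phi>\<close> when the function part dominates, and by the
  square root when the quadratic part does.\<close>
lemma PLK_merit:
  fixes f :: "'a::euclidean_space \<Rightarrow> real"
  assumes "PLK f z \<phi>" "0 < c" "0 < K"
  obtains e \<epsilon> A :: real where "0 < e" "0 < \<epsilon>" "0 < A"
    and "\<And>t. 0 < t \<Longrightarrow> t < e \<Longrightarrow> 0 < deriv \<phi> (t / 2)"
    and "\<And>t. 0 < t \<Longrightarrow> t < e \<Longrightarrow> 0 \<le> \<phi> (t / 2)"
    and "\<And>s t. 0 < s \<Longrightarrow> s \<le> t \<Longrightarrow> t < e \<Longrightarrow>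
      (deriv \<phi> (t / 2) + 1 / sqrt t) * (t - s)
        \<le> (2 * \<phi> (t / 2) + 2 * sqrt t) - (2 * \<phi> (s / 2) + 2 * sqrt s)"
    and "\<And>y d D r. dist y z < \<epsilon> \<Longrightarrow> 0 < r \<Longrightarrow> r < e \<Longrightarrow> r = f y - f z + c * d\<^sup>2 \<Longrightarrow>
      0 \<le> d \<Longrightarrow> d \<le> D \<Longrightarrow> norm (gradient f y) \<le> K * D \<Longrightarrow>
      1 \<le> A * (deriv \<phi> (r / 2) + 1 / sqrt r) * D"
proof -
  obtain \<eta> U where "0 < \<eta>" "open U" "z \<in> U" and des: "desingularizing \<eta> \<phi>"
    and PLK: "\<And>y. y \<in> U \<Longrightarrow> f z < f y \<Longrightarrow> ereal (f y) < ereal (f z) + \<eta> \<Longrightarrow>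
      1 \<le> deriv \<phi> (f y - f z) * norm (gradient f y)"
    using assms(1) unfolding PLK_def by blast
  obtain \<epsilon> where "0 < \<epsilon>" and \<epsilon>: "\<And>y. dist y z < \<epsilon> \<Longrightarrow> y \<in> U"
    using \<open>open U\<close> \<open>z \<in> U\<close> by (auto simp: open_dist)
  obtain e :: real where e0: "0 < e" and e: "ereal e < \<eta>"
    using ereal_dense2[OF \<open>0 < \<eta>\<close>] by (auto simp: zero_ereal_def)
  have lt: "ereal t < \<eta>" if "t < e" for t
    using that e less_trans[of "ereal t" "ereal e"] by simp
  have deriv_pos: "0 < deriv \<phi> t" if "0 < t" "t < e" for t
    using des that lt by (auto simp: desingularizing_def)
  have tangent: "\<phi> s \<le> \<phi> t + deriv \<phi> t * (s - t)" if "0 < s" "s < e" "0 < t" "t < e" for s t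
    using that lt by (intro desingularizing_tangent[OF des]) auto
  have deriv_mono: "deriv \<phi> t \<le> deriv \<phi> s" if "0 < s" "s \<le> t" "t < e" for s t
  proof (cases "s = t")
    case False
    have "0 \<le> (deriv \<phi> s - deriv \<phi> t) * (t - s)"
      using tangent[of s t] tangent[of t s] that by (simp add: algebra_simps)
    then show ?thesis using False that(2) by (simp add: zero_le_mult_iff)
  qed simp
  define A where "A = K + sqrt (2 * c)"
  show ?thesis
  proof (rule that[of e \<epsilon> A])
    show "0 < A" using \<open>0 < c\<close> \<open>0 < K\<close> by (simp add: A_def add_pos_pos)
    show "0 < deriv \<phi> (t / 2)" "0 \<le> \<phi> (t / 2)" if "0 < t" "t < e" for t
      using that deriv_pos[of "t / 2"] des lt[of "t / 2"] by (auto simp: desingularizing_def)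
  next
    fix s t :: real assume st: "0 < s" "s \<le> t" "t < e"
    have "deriv \<phi> (t / 2) * (t - s) \<le> 2 * \<phi> (t / 2) - 2 * \<phi> (s / 2)"
      using tangent[of "s / 2" "t / 2"] st by (simp add: field_simps)
    moreover have "1 / sqrt t * (t - s) \<le> 2 * sqrt t - 2 * sqrt s"
    proof -
      have "sqrt s \<le> sqrt t" "0 < sqrt t" using st by auto
      have "t - s = (sqrt t + sqrt s) * (sqrt t - sqrt s)"
        using st by (simp add: algebra_simps flip: power2_eq_square)
      also have "\<dots> \<le> (2 * sqrt t) * (sqrt t - sqrt s)"
        using \<open>sqrt s \<le> sqrt t\<close> by (intro mult_right_mono) auto
      finally have "t - s \<le> sqrt t * (2 * sqrt t - 2 * sqrt s)" by (simp add: algebra_simps)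
      then show ?thesis using \<open>0 < sqrt t\<close> by (simp add: pos_divide_le_eq mult.commute)
    qed
    ultimately show "(deriv \<phi> (t / 2) + 1 / sqrt t) * (t - s)
        \<le> (2 * \<phi> (t / 2) + 2 * sqrt t) - (2 * \<phi> (s / 2) + 2 * sqrt s)"
      by (simp add: distrib_right)
  next
    fix y and d D r :: real
    assume y: "dist y z < \<epsilon>" and r: "0 < r" "r < e" "r = f y - f z + c * d\<^sup>2"
      and d: "0 \<le> d" "d \<le> D" and grad: "norm (gradient f y) \<le> K * D"
    have "0 \<le> D" using d by simp
    have pos: "0 < deriv \<phi> (r / 2)" "0 < 1 / sqrt r" using r(1,2) deriv_pos[of "r / 2"] by auto
    have "1 \<le> K * deriv \<phi> (r / 2) * D \<or> 1 \<le> sqrt (2 * c) * (1 / sqrt r) * D"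
    proof (cases "r / 2 \<le> f y - f z")
      case True
      have "f y - f z \<le> r" using r(3) \<open>0 < c\<close> by simp
      then have "f y - f z < e" using r(2) by simp
      have "ereal (f y) < ereal (f z) + \<eta>"
      proof -
        have "ereal (f y) < ereal (f z) + ereal e" using \<open>f y - f z < e\<close> by simp
        also have "\<dots> \<le> ereal (f z) + \<eta>" using e by (intro add_left_mono) simp
        finally show ?thesis .
      qed
      then have "1 \<le> deriv \<phi> (f y - f z) * norm (gradient f y)"
        using True r(1) by (intro PLK \<epsilon> y) auto
      also have "\<dots> \<le> deriv \<phi> (r / 2) * (K * D)"
        using True r(1) \<open>f y - f z < e\<close> grad pos
        by (intro mult_mono deriv_mono) auto
      finally show ?thesis by (simp add: mult_ac)
    next
      case False
      then have "r \<le> 2 * c * d\<^sup>2" using r(3) by simp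
      also have "\<dots> \<le> 2 * c * D\<^sup>2" using d \<open>0 < c\<close> by (intro mult_left_mono power_mono) auto
      finally have "sqrt r \<le> sqrt (2 * c * D\<^sup>2)" by simp
      also have "\<dots> = sqrt (2 * c) * D" using \<open>0 \<le> D\<close> by (simp add: real_sqrt_mult)
      finally show ?thesis using r(1) by (simp add: pos_le_divide_eq)
    qed
    moreover have "A * (deriv \<phi> (r / 2) + 1 / sqrt r) * D
        = K * deriv \<phi> (r / 2) * D + sqrt (2 * c) * (1 / sqrt r) * D
          + sqrt (2 * c) * deriv \<phi> (r / 2) * D + K * (1 / sqrt r) * D"
      by (simp add: A_def algebra_simps)
    moreover have "0 \<le> K * deriv \<phi> (r / 2) * D" "0 \<le> sqrt (2 * c) * (1 / sqrt r) * D"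
      "0 \<le> sqrt (2 * c) * deriv \<phi> (r / 2) * D" "0 \<le> K * (1 / sqrt r) * D"
      using pos \<open>0 \<le> D\<close> \<open>0 < c\<close> \<open>0 < K\<close> by auto
    ultimately show "1 \<le> A * (deriv \<phi> (r / 2) + 1 / sqrt r) * D" by linarith
  qed (use \<open>0 < \<epsilon>\<close> e0 in auto)
qed

lemma power_desingularizing_bounds:
  fixes M q t :: real
  assumes "0 < M" "0 \<le> q" "q < 1" "0 < t" "t \<le> 1"
  defines "\<phi> \<equiv> \<lambda>t. M * t powr (1 - q)"
  shows "deriv \<phi> (t / 2) + 1 / sqrt t \<le> (M * (1 - q) * 2 powr q + 1) * t powr (- max q (1 / 2))"
    and "2 * \<phi> (t / 2) + 2 * sqrt t \<le> (2 * M + 2) * t powr (1 - max q (1 / 2))"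
proof -
  have "(\<phi> has_real_derivative M * ((1 - q) * (t / 2) powr (- q))) (at (t / 2))"
    unfolding \<phi>_def using assms by (auto intro!: derivative_eq_intros)
  then have "deriv \<phi> (t / 2) = M * ((1 - q) * (t / 2) powr (- q))" by (rule DERIV_imp_deriv)
  also have "(t / 2) powr (- q) = 2 powr q * t powr (- q)"
    using assms by (simp add: powr_divide powr_minus field_simps)
  also have "t powr (- q) \<le> t powr (- max q (1 / 2))"
    using assms by (intro powr_mono') auto
  finally have d: "deriv \<phi> (t / 2) \<le> M * (1 - q) * 2 powr q * t powr (- max q (1 / 2))"
    using assms by (simp add: mult_ac)
  have "1 / sqrt t = t powr (- (1 / 2))"
    using assms by (simp add: powr_minus powr_half_sqrt inverse_eq_divide)
  also have "\<dots> \<le> t powr (- max q (1 / 2))" using assms by (intro powr_mono') auto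
  finally show "deriv \<phi> (t / 2) + 1 / sqrt t \<le> (M * (1 - q) * 2 powr q + 1) * t powr (- max q (1 / 2))"
    using d by (simp add: distrib_right)
  have "(t / 2) powr (1 - q) \<le> t powr (1 - q)" using assms by (intro powr_mono2) auto
  also have "\<dots> \<le> t powr (1 - max q (1 / 2))" using assms by (intro powr_mono') auto
  finally have "2 * \<phi> (t / 2) \<le> 2 * M * t powr (1 - max q (1 / 2))"
    using assms by (simp add: \<phi>_def)
  moreover have "sqrt t \<le> t powr (1 - max q (1 / 2))"
  proof -
    have "sqrt t = t powr (1 / 2)" using assms by (simp add: powr_half_sqrt)
    also have "\<dots> \<le> t powr (1 - max q (1 / 2))" using assms by (intro powr_mono') auto
    finally show ?thesis .
  qed
  ultimately show "2 * \<phi> (t / 2) + 2 * sqrt t \<le> (2 * M + 2) * t powr (1 - max q (1 / 2))"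
    by (simp add: distrib_right)
qed

lemma geometric_decay:
  fixes r :: "nat \<Rightarrow> real"
  assumes "0 < c" and "\<And>k. k \<ge> N \<Longrightarrow> 0 < r k"
    and "\<And>k. k \<ge> N \<Longrightarrow> c * r k \<le> r k - r (Suc k)"
  obtains C \<mu> where "0 < \<mu>" "\<mu> < 1" "\<And>k. k \<ge> N \<Longrightarrow> r k \<le> C * \<mu> ^ k"
proof -
  define \<mu> where "\<mu> = 1 - c"
  have step: "r (Suc k) \<le> \<mu> * r k" if "k \<ge> N" for k
    using assms(3)[OF that] by (simp add: \<mu>_def algebra_simps)
  have "0 < \<mu> * r N" using step[of N] assms(2)[of "Suc N"] by simp
  then have "0 < \<mu>" using assms(2)[of N] by (simp add: zero_less_mult_iff)
  have "r k \<le> (r N / \<mu> ^ N) * \<mu> ^ k" if "k \<ge> N" for k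
    using that
  proof (induction k rule: dec_induct)
    case base
    then show ?case using \<open>0 < \<mu>\<close> by simp
  next
    case (step k)
    have "r (Suc k) \<le> \<mu> * r k" using step(1) assms(3)[of k] by (simp add: \<mu>_def algebra_simps)
    also have "\<dots> \<le> \<mu> * ((r N / \<mu> ^ N) * \<mu> ^ k)" using step \<open>0 < \<mu>\<close> by (intro mult_left_mono) auto
    finally show ?case by (simp add: mult_ac)
  qed
  moreover have "\<mu> < 1" using \<open>0 < c\<close> by (simp add: \<mu>_def)
  ultimately show ?thesis using that \<open>0 < \<mu>\<close> by blast
qed

text \<open>By convexity of \<open>t powr (- p)\<close>, the sequence \<open>r k powr (- p)\<close> grows at least linearly.\<close>
lemma polynomial_decay:
  fixes r :: "nat \<Rightarrow> real"
  assumes "0 < c" "0 < p" and pos: "\<And>k. k \<ge> N \<Longrightarrow> 0 < r k"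
    and dec: "\<And>k. k \<ge> N \<Longrightarrow> c * r k powr (p + 1) \<le> r k - r (Suc k)"
  obtains C where "0 < C" "eventually (\<lambda>k. r k \<le> C * real k powr (- (1 / p))) sequentially"
proof -
  have conv: "convex_on {0<..} (\<lambda>t::real. t powr (- p))"
  proof (rule f''_ge0_imp_convex)
    show "((\<lambda>t. t powr (- p)) has_real_derivative (- p) * t powr (- p - 1)) (at t)"
      if "t \<in> {0<..}" for t :: real
      using that by (auto intro!: derivative_eq_intros)
    show "((\<lambda>t. (- p) * t powr (- p - 1)) has_real_derivative
        (- p) * ((- p - 1) * t powr (- p - 1 - 1))) (at t)" if "t \<in> {0<..}" for t :: real
      using that by (auto intro!: derivative_eq_intros)
    show "0 \<le> (- p) * ((- p - 1) * t powr (- p - 1 - 1))" if "t \<in> {0<..}" for t :: real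
      using \<open>0 < p\<close> by (intro mult_nonpos_nonpos mult_nonpos_nonneg) auto
  qed simp
  have growth: "r k powr (- p) + p * c \<le> r (Suc k) powr (- p)" if k: "k \<ge> N" for k
  proof -
    have "(- p) * r k powr (- p - 1) * (r (Suc k) - r k) \<le> r (Suc k) powr (- p) - r k powr (- p)"
      using pos[of k] pos[of "Suc k"] k
      by (intro convex_on_imp_above_tangent[OF conv])
         (auto simp: interior_open intro!: derivative_eq_intros)
    then have slope: "p * r k powr (- p - 1) * (r k - r (Suc k)) \<le> r (Suc k) powr (- p) - r k powr (- p)"
      by (simp add: algebra_simps)
    have "p * r k powr (- p - 1) * (c * r k powr (p + 1))
        \<le> p * r k powr (- p - 1) * (r k - r (Suc k))"
      using dec[OF k] \<open>0 < p\<close> by (intro mult_left_mono) auto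
    moreover have "r k powr (- p - 1) * r k powr (p + 1) = 1"
      using pos[OF k] by (simp flip: powr_add)
    then have "p * r k powr (- p - 1) * (c * r k powr (p + 1)) = p * c"
      by (simp add: mult_ac)
    ultimately show ?thesis using slope by linarith
  qed
  have lin: "p * c * real (k - N) \<le> r k powr (- p)" if "k \<ge> N" for k
    using that
  proof (induction k rule: dec_induct)
    case (step k)
    have "p * c * real (Suc k - N) = p * c * real (k - N) + p * c"
      using step(1) by (simp add: Suc_diff_le distrib_left)
    then show ?case using step(3) growth[OF step(1)] by linarith
  qed simp
  define C where "C = (p * c / 2) powr (- (1 / p))"
  show ?thesis
  proof (rule that[of C])
    show "0 < C" using \<open>0 < p\<close> \<open>0 < c\<close> by (simp add: C_def)
    have "r k \<le> C * real k powr (- (1 / p))" if k: "k \<ge> 2 * N + 1" for k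
    proof -
      have "p * c / 2 * real k \<le> p * c * real (k - N)"
        using k \<open>0 < p\<close> \<open>0 < c\<close> by (simp add: of_nat_diff field_simps)
      then have "p * c / 2 * real k \<le> r k powr (- p)" using lin[of k] k by simp
      then have "(r k powr (- p)) powr (- (1 / p)) \<le> (p * c / 2 * real k) powr (- (1 / p))"
        using k \<open>0 < p\<close> \<open>0 < c\<close> by (intro powr_mono2') auto
      also have "(r k powr (- p)) powr (- (1 / p)) = r k"
        using pos[of k] k \<open>0 < p\<close> by (simp add: powr_powr)
      also have "(p * c / 2 * real k) powr (- (1 / p)) = C * real k powr (- (1 / p))"
        unfolding C_def by (rule powr_mult)
      finally show ?thesis .
    qed
    then show "eventually (\<lambda>k. r k \<le> C * real k powr (- (1 / p))) sequentially"
      unfolding eventually_sequentially by blast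
  qed
qed

lemma converges_linearlyI:
  assumes "0 < \<mu>" "\<mu> < 1" and bound: "\<And>k. k \<ge> N \<Longrightarrow> norm (u k - l) \<le> C * \<mu> ^ k"
  shows "converges_linearly u l"
proof -
  have "eventually (\<lambda>k. norm (norm (u k - l)) \<le> C * norm (\<mu> ^ k)) sequentially"
    using eventually_ge_at_top[of N] by eventually_elim (use assms in auto)
  then have "(\<lambda>k. norm (u k - l)) \<in> O(\<lambda>k. \<mu> ^ k)" by (rule bigoI)
  then show ?thesis using assms(1,2) unfolding converges_linearly_def by blast
qed

theorem theorem3p5:
  fixes f :: "real ^ 'n \<Rightarrow> real"
    and x :: "nat \<Rightarrow> real ^ 'n"
    and \<beta> \<gamma> :: "nat \<Rightarrow> real"
    and L \<nu> \<tau> :: real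
  assumes "continuously_differentiable f"
    and "0 < L"
    and "\<And>y z. norm (gradient f y - gradient f z) \<le> L * norm (y - z)"
    and "IGDm f \<beta> \<gamma> \<nu> \<tau> x"
    and "\<And>k. k \<ge> 1 \<Longrightarrow> gradient f (extrapolation \<gamma> x k) \<noteq> 0"
    and "max (L * \<tau>)
           (2 * L * \<tau> * delta_bar \<beta> \<gamma> + (L * \<tau> + 1) * (beta_bar \<beta>)\<^sup>2) < 1 - \<nu>"
    and "bdd_below ((\<lambda>k. f (x k)) ` {1..})"
  shows "((\<lambda>k. gradient f (x k)) \<longlonglongrightarrow> 0) \<and>
    (\<forall>xbar. accumulation_point x xbar \<and> basic_PLK f xbar \<longrightarrow>
       x \<longlonglongrightarrow> xbar \<and> stationary_point f xbar) \<and>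
    (\<forall>xbar M q. accumulation_point x xbar \<and> 0 < M \<and> 0 \<le> q \<and> q < 1 \<and>
       PLK f xbar (\<lambda>t. M * t powr (1 - q)) \<longrightarrow>
       (q \<le> 1 / 2 \<longrightarrow>
          converges_linearly x xbar \<and>
          converges_linearly (\<lambda>k. gradient f (x k)) 0 \<and>
          converges_linearly (\<lambda>k. f (x k)) (f xbar)) \<and>
       (1 / 2 < q \<longrightarrow>
          (\<lambda>k. norm (x k - xbar)) \<in> O(\<lambda>k. real k powr (- ((1 - q) / (2 * q - 1)))) \<and>
          (\<lambda>k. norm (gradient f (x k))) \<in> O(\<lambda>k. real k powr (- ((1 - q) / (2 * q - 1)))) \<and>
          (\<lambda>k. f (x k) - f xbar) \<in> O(\<lambda>k. real k powr (- ((2 - 2 * q) / (2 * q - 1))))))"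
proof -
  have deriv: "GDERIV f z :> gradient f z" for z
    using assms(1) differentiable_GDERIV_gradient by (auto simp: continuously_differentiable_def)
  have f_cont: "isCont f z" for z
    using deriv[of z] by (auto simp: gderiv_def intro: has_derivative_continuous)
  obtain c \<rho> K D where "0 < c" "0 < \<rho>" "0 < K"
    and D_pos: "\<And>k. k \<ge> 1 \<Longrightarrow> 0 < D k"
    and D_prev: "\<And>k. k \<ge> 1 \<Longrightarrow> norm (x k - x (k - 1)) \<le> D k"
    and D_next: "\<And>k. k \<ge> 1 \<Longrightarrow> dist (x (Suc k)) (x k) \<le> D k"
    and D_grad: "\<And>k. k \<ge> 1 \<Longrightarrow> norm (gradient f (x k)) \<le> K * D k"
    and merit: "\<And>k. k \<ge> 1 \<Longrightarrow> \<rho> * (D k)\<^sup>2 \<le> (f (x k) + c * (norm (x k - x (k - 1)))\<^sup>2)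
           - (f (x (Suc k)) + c * (norm (x (Suc k) - x k))\<^sup>2)"
    using IGDm_merit_decrease[OF deriv assms(3,2,4,5,6)] by blast
  define H where "H k = f (x k) + c * (norm (x k - x (k - 1)))\<^sup>2" for k
  have dec: "\<rho> * (D k)\<^sup>2 \<le> H k - H (Suc k)" if "k \<ge> 1" for k
    using merit[OF that] by (simp add: H_def)
  have H_less: "H (Suc k) < H k" if "k \<ge> 1" for k
  proof -
    have "0 < \<rho> * (D k)\<^sup>2" using D_pos[OF that] \<open>0 < \<rho>\<close> by simp
    then show ?thesis using dec[OF that] by linarith
  qed
  obtain lb where lb: "\<And>k. k \<ge> 1 \<Longrightarrow> lb \<le> f (x k)"
    using assms(7) by (auto simp: bdd_below_def)
  have "decseq (\<lambda>k. H (Suc k))" using H_less by (auto simp: decseq_Suc_iff less_imp_le)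
  moreover have "lb \<le> H (Suc k)" for k
    using lb[of "Suc k"] \<open>0 < c\<close> by (simp add: H_def add_increasing2)
  ultimately obtain h where h: "(\<lambda>k. H (Suc k)) \<longlonglongrightarrow> h" "\<And>k. h \<le> H (Suc k)"
    using decseq_convergent by metis
  then have H_lim: "H \<longlonglongrightarrow> h" by (simp add: filterlim_sequentially_Suc)
  have H_gt: "h < H k" if "k \<ge> 1" for k
    using h(2)[of k] H_less[OF that] by simp
  have "(\<lambda>k. (D k)\<^sup>2) \<longlonglongrightarrow> 0"
  proof (rule tendsto_sandwich[of "\<lambda>_. 0"])
    show "(\<lambda>k. (H k - H (Suc k)) / \<rho>) \<longlonglongrightarrow> 0"
      using tendsto_divide[OF tendsto_diff[OF H_lim h(1)] tendsto_const[of \<rho>]] \<open>0 < \<rho>\<close> by simp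
    show "eventually (\<lambda>k. (D k)\<^sup>2 \<le> (H k - H (Suc k)) / \<rho>) sequentially"
      unfolding eventually_sequentially using dec \<open>0 < \<rho>\<close>
      by (intro exI[of _ 1]) (auto simp: pos_le_divide_eq mult.commute)
  qed auto
  then have D_lim: "D \<longlonglongrightarrow> 0" by simp
  have grad_lim: "(\<lambda>k. gradient f (x k)) \<longlonglongrightarrow> 0"
  proof (rule Lim_null_comparison)
    show "eventually (\<lambda>k. norm (gradient f (x k)) \<le> K * D k) sequentially"
      unfolding eventually_sequentially using D_grad by blast
    show "(\<lambda>k. K * D k) \<longlonglongrightarrow> 0" using tendsto_mult_right_zero[OF D_lim] .
  qed
  have fx_lim: "(\<lambda>k. f (x k)) \<longlonglongrightarrow> h"
  proof -
    have "(\<lambda>k. norm (x k - x (k - 1))) \<longlonglongrightarrow> 0"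
    proof (rule Lim_null_comparison)
      show "eventually (\<lambda>k. norm (norm (x k - x (k - 1))) \<le> D k) sequentially"
        unfolding eventually_sequentially using D_prev by auto
    qed (rule D_lim)
    then have "(\<lambda>k. H k - c * (norm (x k - x (k - 1)))\<^sup>2) \<longlonglongrightarrow> h - c * 0\<^sup>2"
      by (intro tendsto_intros H_lim)
    then show ?thesis by (simp add: H_def)
  qed
  have PLK_convergence: "\<exists>A N. 0 < A \<and> x \<longlonglongrightarrow> z \<and> h = f z \<and> (\<forall>k\<ge>N. k \<ge> 1 \<and> H k - h \<le> 1 \<and>
      1 \<le> A * (deriv \<phi> ((H k - h) / 2) + 1 / sqrt (H k - h)) * D k \<and>
      \<rho> * dist (x k) z \<le> A * (2 * \<phi> ((H k - h) / 2) + 2 * sqrt (H k - h)))"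
    if acc: "accumulation_point x z" and PLK: "PLK f z \<phi>" for z \<phi>
  proof -
    obtain s where "strict_mono s" "(x \<circ> s) \<longlonglongrightarrow> z"
      using acc by (auto simp: accumulation_point_def)
    then have "(\<lambda>k. f (x (s k))) \<longlonglongrightarrow> h" "(\<lambda>k. f (x (s k))) \<longlonglongrightarrow> f z"
      using LIMSEQ_subseq_LIMSEQ[OF fx_lim, of s] isCont_tendsto_compose[OF f_cont, of "x \<circ> s"]
      by (simp_all add: o_def)
    then have "h = f z" by (rule LIMSEQ_unique)
    obtain e \<epsilon> A :: real where "0 < e" "0 < \<epsilon>" "0 < A"
      and dpos: "\<And>t. 0 < t \<Longrightarrow> t < e \<Longrightarrow> 0 < deriv \<phi> (t / 2)"
      and nonneg: "\<And>t. 0 < t \<Longrightarrow> t < e \<Longrightarrow> 0 \<le> \<phi> (t / 2)"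
      and tangent: "\<And>s t. 0 < s \<Longrightarrow> s \<le> t \<Longrightarrow> t < e \<Longrightarrow>
        (deriv \<phi> (t / 2) + 1 / sqrt t) * (t - s)
          \<le> (2 * \<phi> (t / 2) + 2 * sqrt t) - (2 * \<phi> (s / 2) + 2 * sqrt s)"
      and slope: "\<And>y d D r. dist y z < \<epsilon> \<Longrightarrow> 0 < r \<Longrightarrow> r < e \<Longrightarrow> r = f y - f z + c * d\<^sup>2 \<Longrightarrow>
        0 \<le> d \<Longrightarrow> d \<le> D \<Longrightarrow> norm (gradient f y) \<le> K * D \<Longrightarrow>
        1 \<le> A * (deriv \<phi> (r / 2) + 1 / sqrt r) * D"
      using PLK_merit[OF PLK \<open>0 < c\<close> \<open>0 < K\<close>] by blast
    define w where "w t = A * (deriv \<phi> (t / 2) + 1 / sqrt t)" for t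
    define \<Phi> where "\<Phi> t = A * (2 * \<phi> (t / 2) + 2 * sqrt t)" for t
    obtain N where "N \<ge> 1" "x \<longlonglongrightarrow> z"
      and N: "\<And>k. k \<ge> N \<Longrightarrow> H k - h < min e 1 \<and> 1 \<le> w (H k - h) * D k \<and>
        \<rho> * dist (x k) z \<le> \<Phi> (H k - h)"
    proof (rule desingularized_descent_converges[of "min e 1" \<epsilon> \<rho> 1 "\<lambda>k. H k - h" D x z w \<Phi>])
      show "(\<lambda>k. H k - h) \<longlonglongrightarrow> 0" using H_lim by (simp add: LIM_zero)
      show "1 \<le> w (H k - h) * D k"
        if "k \<ge> 1" "dist (x k) z < \<epsilon>" "H k - h < min e 1" for k
        unfolding w_def
        using that H_gt[OF that(1)] D_prev[OF that(1)] D_grad[OF that(1)] \<open>h = f z\<close>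
        by (intro slope[of "x k" _ "norm (x k - x (k - 1))"]) (auto simp: H_def)
      show "0 \<le> w t" if "0 < t" "t < min e 1" for t
        using that dpos[of t] \<open>0 < A\<close> by (simp add: w_def)
      show "0 \<le> \<Phi> t" if "0 < t" "t < min e 1" for t
        using that nonneg[of t] \<open>0 < A\<close> by (simp add: \<Phi>_def)
      show "w t * (t - s) \<le> \<Phi> t - \<Phi> s" if "0 < s" "s \<le> t" "t < min e 1" for s t
        using mult_left_mono[OF tangent[of s t], of A] that \<open>0 < A\<close>
        by (simp add: w_def \<Phi>_def algebra_simps)
    qed (use \<open>0 < e\<close> \<open>0 < \<epsilon>\<close> \<open>0 < \<rho>\<close> H_gt dec D_next acc in auto)
    then show ?thesis
      using \<open>0 < A\<close> \<open>h = f z\<close> unfolding w_def \<Phi>_def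
      by (intro exI[of _ A] exI[of _ N]) (auto simp: less_imp_le)
  qed
  have stationary: "gradient f z = 0" if "x \<longlonglongrightarrow> z" for z
  proof -
    have "isCont (gradient f) z"
      using assms(1) by (simp add: continuously_differentiable_def continuous_on_eq_continuous_at)
    then have "(\<lambda>k. gradient f (x k)) \<longlonglongrightarrow> gradient f z"
      using that by (rule isCont_tendsto_compose)
    then show ?thesis using grad_lim LIMSEQ_unique by blast
  qed
  have part_ii: "x \<longlonglongrightarrow> z \<and> stationary_point f z"
    if "accumulation_point x z" "basic_PLK f z" for z
    using that PLK_convergence stationary assms(1)
    unfolding basic_PLK_def stationary_point_def continuously_differentiable_def by blast
  have part_iii: "(q \<le> 1 / 2 \<longrightarrow>
          converges_linearly x z \<and>
          converges_linearly (\<lambda>k. gradient f (x k)) 0 \<and>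
          converges_linearly (\<lambda>k. f (x k)) (f z)) \<and>
       (1 / 2 < q \<longrightarrow>
          (\<lambda>k. norm (x k - z)) \<in> O(\<lambda>k. real k powr (- ((1 - q) / (2 * q - 1)))) \<and>
          (\<lambda>k. norm (gradient f (x k))) \<in> O(\<lambda>k. real k powr (- ((1 - q) / (2 * q - 1)))) \<and>
          (\<lambda>k. f (x k) - f z) \<in> O(\<lambda>k. real k powr (- ((2 - 2 * q) / (2 * q - 1)))))"
    if acc: "accumulation_point x z" and M: "0 < M" and q: "0 \<le> q" "q < 1"
      and PLK: "PLK f z (\<lambda>t. M * t powr (1 - q))" for z M q
  proof -
    define \<theta> where "\<theta> = max q (1 / 2)"
    define r where "r k = H k - h" for k
    have "\<theta> < 1" using q by (simp add: \<theta>_def)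
    obtain A N where "0 < A" "x \<longlonglongrightarrow> z" "h = f z"
      and N: "\<And>k. k \<ge> N \<Longrightarrow> k \<ge> 1 \<and> r k \<le> 1 \<and>
      1 \<le> A * (deriv (\<lambda>t. M * t powr (1 - q)) (r k / 2) + 1 / sqrt (r k)) * D k \<and>
      \<rho> * dist (x k) z \<le> A * (2 * (M * (r k / 2) powr (1 - q)) + 2 * sqrt (r k))"
      using PLK_convergence[OF acc PLK] unfolding r_def by blast
    have r_pos: "0 < r k" if "k \<ge> N" for k using H_gt[of k] N[OF that] by (simp add: r_def)
    define A1 where "A1 = A * (M * (1 - q) * 2 powr q + 1)"
    have "0 < A1" using \<open>0 < A\<close> M q by (simp add: A1_def add_nonneg_pos)
    define A2 where "A2 = A * (2 * M + 2) / \<rho>"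
    have "0 < A2" using \<open>0 < A\<close> M \<open>0 < \<rho>\<close> by (simp add: A2_def)
    have near: "norm (x k - z) \<le> A2 * r k powr (1 - \<theta>)" if "k \<ge> N" for k
    proof -
      have "A * (2 * (M * (r k / 2) powr (1 - q)) + 2 * sqrt (r k))
          \<le> A * ((2 * M + 2) * r k powr (1 - \<theta>))"
        using power_desingularizing_bounds(2)[OF M q r_pos[OF that]] N[OF that] \<open>0 < A\<close>
        unfolding \<theta>_def by (intro mult_left_mono) auto
      then have "\<rho> * norm (x k - z) \<le> A * ((2 * M + 2) * r k powr (1 - \<theta>))"
        using N[OF that] by (simp add: dist_norm)
      then show ?thesis using \<open>0 < \<rho>\<close> by (simp add: A2_def field_simps)
    qed
    have grow: "(\<rho> / A1\<^sup>2) * r k powr (2 * \<theta>) \<le> r k - r (Suc k)" if "k \<ge> N" for k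
    proof -
      have "0 < D k" using N[OF that] D_pos by blast
      have "1 \<le> A * (deriv (\<lambda>t. M * t powr (1 - q)) (r k / 2) + 1 / sqrt (r k)) * D k"
        using N[OF that] by blast
      also have "\<dots> \<le> A * ((M * (1 - q) * 2 powr q + 1) * r k powr (- \<theta>)) * D k"
        using power_desingularizing_bounds(1)[OF M q r_pos[OF that]] N[OF that] \<open>0 < A\<close> \<open>0 < D k\<close>
        unfolding \<theta>_def by (intro mult_left_mono mult_right_mono) auto
      also have "\<dots> = A1 * D k / r k powr \<theta>"
        by (simp add: A1_def powr_minus field_simps)
      finally have "r k powr \<theta> \<le> A1 * D k"
        using r_pos[OF that] by (simp add: pos_le_divide_eq)
      then have "(r k powr \<theta>)\<^sup>2 \<le> (A1 * D k)\<^sup>2" by (intro power_mono) auto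
      moreover have "r k powr (2 * \<theta>) = (r k powr \<theta>)\<^sup>2"
        by (simp only: mult_2 powr_add power2_eq_square)
      ultimately have "r k powr (2 * \<theta>) \<le> A1\<^sup>2 * (D k)\<^sup>2"
        by (simp add: power_mult_distrib)
      then have "(\<rho> / A1\<^sup>2) * r k powr (2 * \<theta>) \<le> \<rho> / A1\<^sup>2 * (A1\<^sup>2 * (D k)\<^sup>2)"
        using \<open>0 < \<rho>\<close> by (intro mult_left_mono) auto
      also have "\<dots> = \<rho> * (D k)\<^sup>2" using \<open>0 < A1\<close> by simp
      also have "\<dots> \<le> r k - r (Suc k)" using dec N[OF that] by (simp add: r_def)
      finally show ?thesis .
    qed
    have gz: "gradient f z = 0" using stationary[OF \<open>x \<longlonglongrightarrow> z\<close>] .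
    have grad_le: "norm (gradient f (x k)) \<le> L * norm (x k - z)" for k
      using assms(3)[of "x k" z] gz by simp
    have f_le: "norm (f (x k) - f z) \<le> L / 2 * (norm (x k - z))\<^sup>2" for k
      using lipschitz_gradient_upper_bound[OF deriv assms(3), of "x k" z]
        lipschitz_gradient_lower_bound[OF deriv assms(3), of z "x k"] gz
      unfolding real_norm_def by (intro abs_leI) simp_all
    show ?thesis
    proof (intro conjI impI)
      assume "q \<le> 1 / 2"
      then have \<theta>: "\<theta> = 1 / 2" by (simp add: \<theta>_def)
      have lin: "(\<rho> / A1\<^sup>2) * r k \<le> r k - r (Suc k)" if "k \<ge> N" for k
        using grow[OF that] r_pos[OF that] \<theta> by simp
      obtain C \<mu> where \<mu>: "0 < \<mu>" "\<mu> < 1" and C: "\<And>k. k \<ge> N \<Longrightarrow> r k \<le> C * \<mu> ^ k"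
        by (rule geometric_decay[of "\<rho> / A1\<^sup>2" N r]) (use \<open>0 < \<rho>\<close> \<open>0 < A1\<close> r_pos lin in auto)
      have nx: "norm (x k - z) \<le> A2 * sqrt C * sqrt \<mu> ^ k" if "k \<ge> N" for k
      proof -
        have "sqrt (r k) \<le> sqrt (C * \<mu> ^ k)" using C[OF that] by simp
        then have "A2 * sqrt (r k) \<le> A2 * (sqrt C * sqrt \<mu> ^ k)"
          using \<open>0 < A2\<close> by (simp add: real_sqrt_mult real_sqrt_power)
        then show ?thesis
          using near[OF that] r_pos[OF that] \<theta> by (simp add: powr_half_sqrt mult.assoc)
      qed
      show "converges_linearly x z"
        using nx by (rule converges_linearlyI[rotated 2]) (use \<mu> in auto)
      have "norm (gradient f (x k) - 0) \<le> L * (A2 * sqrt C) * sqrt \<mu> ^ k" if "k \<ge> N" for k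
        using order_trans[OF grad_le mult_left_mono[OF nx[OF that]]] \<open>0 < L\<close>
        by (simp add: mult.assoc)
      then show "converges_linearly (\<lambda>k. gradient f (x k)) 0"
        by (rule converges_linearlyI[rotated 2]) (use \<mu> in auto)
      have "norm (f (x k) - f z) \<le> L / 2 * (A2 * sqrt C)\<^sup>2 * \<mu> ^ k" if "k \<ge> N" for k
      proof -
        have "(norm (x k - z))\<^sup>2 \<le> (A2 * sqrt C * sqrt \<mu> ^ k)\<^sup>2"
          using nx[OF that] by (intro power_mono) auto
        also have "\<dots> = (A2 * sqrt C)\<^sup>2 * \<mu> ^ k"
          using \<mu> by (simp add: power_mult_distrib real_sqrt_power[symmetric])
        finally have "L / 2 * (norm (x k - z))\<^sup>2 \<le> L / 2 * ((A2 * sqrt C)\<^sup>2 * \<mu> ^ k)"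
          using \<open>0 < L\<close> by (intro mult_left_mono) auto
        then show ?thesis using f_le[of k] by (simp add: mult.assoc)
      qed
      then show "converges_linearly (\<lambda>k. f (x k)) (f z)"
        by (rule converges_linearlyI[rotated 2]) (use \<mu> in auto)
    next
      assume q2: "1 / 2 < q"
      define a where "a = (1 - q) / (2 * q - 1)"
      have \<theta>: "\<theta> = q" using q2 by (simp add: \<theta>_def)
      obtain C where "0 < C" and C: "eventually (\<lambda>k. r k \<le> C * real k powr (- (1 / (2 * q - 1)))) sequentially"
        by (rule polynomial_decay[of "\<rho> / A1\<^sup>2" "2 * q - 1" N r])
           (use \<open>0 < \<rho>\<close> \<open>0 < A1\<close> q2 r_pos grow \<theta> in auto)
      define A3 where "A3 = A2 * C powr (1 - q)"
      have nx: "eventually (\<lambda>k. norm (x k - z) \<le> A3 * real k powr (- a)) sequentially"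
        using C eventually_ge_at_top[of N]
      proof eventually_elim
        case (elim k)
        have "r k powr (1 - q) \<le> (C * real k powr (- (1 / (2 * q - 1)))) powr (1 - q)"
          using elim r_pos[of k] q by (intro powr_mono2) auto
        also have "\<dots> = C powr (1 - q) * real k powr (- a)"
          using \<open>0 < C\<close> by (simp add: powr_mult powr_powr a_def)
        finally have "A2 * r k powr (1 - q) \<le> A2 * (C powr (1 - q) * real k powr (- a))"
          using \<open>0 < A2\<close> by (intro mult_left_mono) auto
        then show ?case using near[of k] elim \<theta> by (simp add: A3_def mult.assoc)
      qed
      show x_O: "(\<lambda>k. norm (x k - z)) \<in> O(\<lambda>k. real k powr (- ((1 - q) / (2 * q - 1))))"
        using nx unfolding a_def by (intro bigoI[of _ A3]) simp
      have "(\<lambda>k. norm (gradient f (x k))) \<in> O(\<lambda>k. norm (x k - z))"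
        using grad_le by (intro bigoI[of _ L]) simp
      then show "(\<lambda>k. norm (gradient f (x k))) \<in> O(\<lambda>k. real k powr (- ((1 - q) / (2 * q - 1))))"
        using x_O by (rule landau_o.big_trans)
      have "(\<lambda>k. f (x k) - f z) \<in> O(\<lambda>k. (norm (x k - z))\<^sup>2)"
        using f_le by (intro bigoI[of _ "L / 2"]) simp
      also have "(\<lambda>k. (norm (x k - z))\<^sup>2) \<in> O(\<lambda>k. (real k powr (- a))\<^sup>2)"
        using x_O unfolding a_def by (rule landau_o.big_power)
      also have "(\<lambda>k. (real k powr (- a))\<^sup>2) = (\<lambda>k. real k powr (- ((2 - 2 * q) / (2 * q - 1))))"
      proof
        fix k
        have "(2 - 2 * q) / (2 * q - 1) = a + a"
          unfolding a_def add_divide_distrib[symmetric] by simp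
        then have "- ((2 - 2 * q) / (2 * q - 1)) = - a + - a"
          by linarith
        then show "(real k powr (- a))\<^sup>2 = real k powr (- ((2 - 2 * q) / (2 * q - 1)))"
          by (simp only: powr_add power2_eq_square)
      qed
      finally show "(\<lambda>k. f (x k) - f z) \<in> O(\<lambda>k. real k powr (- ((2 - 2 * q) / (2 * q - 1))))" .
    qed
  qed
  show ?thesis
    using grad_lim part_ii part_iii by blast
qed

end
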